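(* Let $m,n$ be positive integers and let $\phi:\mathcal{T}_{m,n}\to\mathcal{T}_{m,n}$ be a linear bijection. Then $\phi$ is a rank preserver (i.e. $\mathrm{rank}(\phi(\mathcal{A}))=\mathrm{rank}(\mathcal{A})$ for every $\mathcal{A}\in\mathcal{T}_{m,n}$) if and only if there exist invertible matrices $B_1,\dots,B_m\in\mathbb{R}^{n\times n}$ and a permutation $\tau\in S_m$ such that $\phi(\mathcal{A})=(\mathcal{B}\times\mathcal{A})\times\mathcal{K}^{\tau}$ for all $\mathcal{A}\in\mathcal{T}_{m,n}$, where $\mathcal{B}:=B_1\times B_2\times\cdots\times B_m$.
   Context: $\mathcal{T}_{m,n}$ is the set of real $m$-th order tensors with all dimensions $n$, and the rank of a tensor is its CP rank: the smallest $R$ such that it is a sum of $R$ tensors of the form $\alpha_1\times\cdots\times\alpha_m$ (entries $(\alpha_1)_{i_1}\cdots(\alpha_m)_{i_m}$, $\alpha_k\in\mathbb{R}^n$). For matrices $B_k=(b^{(k)}_{ij})\in\mathbb{R}^{n\times n}$, $\mathcal{B}=B_1\times\cdots\times B_m$ is the $2m$-order tensor with entries $B_{i_1\dots i_m;j_1\dots j_m}=b^{(1)}_{i_1j_1}\cdots b^{(m)}_{i_mj_m}$, and $(\mathcal{B}\times\mathcal{A})_{i_1\dots i_m}=\sum_{j_1,\dots,j_m}B_{i_1\dots i_m;j_1\dots j_m}A_{j_1\dots j_m}$. For $\tau\in S_m$, $\mathcal{K}^{\tau}$ is the $2m$-order $(0,1)$-tensor with $K^{\tau}_{i_1\dots i_m;j_1\dots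 j_m}=1$ iff $j_k=i_{\tau(k)}$ for all $k$, and for $\mathcal{C}\in\mathcal{T}_{m,n}$, $(\mathcal{C}\times\mathcal{K}^{\tau})_{i_1\dots i_m}=\sum_{k_1,\dots,k_m}C_{k_1\dots k_m}K^{\tau}_{k_1\dots k_m;i_1\dots i_m}$. *)

theory Defs
  imports "HOL-Analysis.Analysis" "HOL-Combinatorics.Permutations"
begin

text \<open>
  The order \<open>m\<close> and the dimension \<open>n\<close> are the cardinalities of the finite (hence nonempty) types
  \<open>'m\<close> and \<open>'n\<close>. A multi-index \<open>(i\<^sub>1, \<dots>, i\<^sub>m)\<close> is a function \<open>'m \<Rightarrow> 'n\<close>.
  A tensor of order \<open>2m\<close> with entries \<open>T\<^bsub>i;j\<^esub>\<close> is a matrix whose rows and columns are labelled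
  by multi-indices, with entry \<open>T $ i $ j\<close>; its contractions with a tensor of order \<open>m\<close>
  from the right and from the left are then the library products \<open>*v\<close> and \<open>v*\<close>.
\<close>

type_synonym ('m, 'n) tensor = "real ^ ('m \<Rightarrow> 'n)"

type_synonym ('m, 'n) tensor2 = "real ^ ('m \<Rightarrow> 'n) ^ ('m \<Rightarrow> 'n)"

definition outer_prod :: "('m::finite \<Rightarrow> real ^ 'n::finite) \<Rightarrow> ('m, 'n) tensor" where
  "outer_prod \<alpha> = (\<chi> i. \<Prod>k\<in>UNIV. \<alpha> k $ i k)"

definition cp_rank :: "('m::finite, 'n::finite) tensor \<Rightarrow> nat" where
  "cp_rank A =
    (LEAST R. \<exists>\<alpha> :: nat \<Rightarrow> 'm \<Rightarrow> real ^ 'n. A = (\<Sum>r<R. outer_prod (\<alpha> r)))"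

definition rank_preserver ::
    "(('m::finite, 'n::finite) tensor \<Rightarrow> ('m, 'n) tensor) \<Rightarrow> bool" where
  "rank_preserver \<phi> \<longleftrightarrow> (\<forall>A. cp_rank (\<phi> A) = cp_rank A)"

definition matrix_outer_prod ::
    "('m::finite \<Rightarrow> real ^ 'n::finite ^ 'n) \<Rightarrow> ('m, 'n) tensor2" where
  "matrix_outer_prod B = (\<chi> i j. \<Prod>k\<in>UNIV. B k $ i k $ j k)"

definition perm_tensor :: "('m::finite \<Rightarrow> 'm) \<Rightarrow> ('m, 'n::finite) tensor2" where
  "perm_tensor \<tau> = (\<chi> i j. if \<forall>k. j k = i (\<tau> k) then 1 else 0)"

end

theory Submission imports Defs begin

text \<open>
  A sum of two nonzero outer products is again an outer product iff their factors are proportional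
  in all coordinates but at most one. Hence a rank preserver acts on nonzero outer products modulo
  scalars as an automorphism of the Hamming graph on tuples of points of the projective space.
  Such an automorphism maps each family of parallel lines to a family of parallel lines, which gives
  the permutation of the factors. Moving a single factor away from a base tensor then defines a
  linear map in each coordinate; the preserver agrees with the resulting factorwise map up to a
  scalar on each outer product, and additivity in one coordinate at a time forces
  all these scalars to be 1. In dimension 1 the projective space is a single point and every
  permutation serves.
\<close>

section \<open>Automorphisms of Hamming graphs\<close>

text \<open>The coordinates where \<open>a\<close> and \<open>b\<close> disagree are overwritten one
  at a time; every intermediate tuple stays over \<open>S\<close>.\<close>

lemma change_coordinates_induct:
  fixes a b :: "'m::finite \<Rightarrow> 'p"
  assumes a: "range a \<subseteq> S" and b: "range b \<subseteq> S" and "P a"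
    and step: "\<And>c l. range c \<subseteq> S \<Longrightarrow> a l \<noteq> b l \<Longrightarrow> P c \<Longrightarrow> P (c(l := b l))"
  shows "P b"
proof -
  have "P (\<lambda>j. if j \<in> A then b j else a j)" if "finite A" "A \<subseteq> {j. a j \<noteq> b j}" for A
    using that
  proof induction
    case empty
    then show ?case using \<open>P a\<close> by simp
  next
    case (insert l A)
    let ?c = "\<lambda>j. if j \<in> A then b j else a j"
    have "range ?c \<subseteq> S" using a b by auto
    then have "P (?c(l := b l))" using insert step by auto
    moreover have "?c(l := b l) = (\<lambda>j. if j \<in> insert l A then b j else a j)" by auto
    ultimately show ?case by simp
  qed
  from this[of "{j. a j \<noteq> b j}"] have "P (\<lambda>j. if a j \<noteq> b j then b j else a j)" by simp
  moreover have "(\<lambda>j. if a j \<noteq> b j then b j else a j) = b" by auto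
  ultimately show ?thesis by simp
qed

text \<open>Vertices are the tuples over \<open>S\<close>. The inclusions into \<open>{k}\<close>
  express that two tuples are adjacent or equal.\<close>

locale hamming_automorphism =
  fixes S :: "'p set" and F :: "('m::finite \<Rightarrow> 'p) \<Rightarrow> 'm \<Rightarrow> 'p"
  assumes inj: "\<lbrakk>range a \<subseteq> S; range b \<subseteq> S; F a = F b\<rbrakk> \<Longrightarrow> a = b"
    and adj: "\<lbrakk>range a \<subseteq> S; range b \<subseteq> S\<rbrakk> \<Longrightarrow>
      (\<exists>k. {j. F a j \<noteq> F b j} \<subseteq> {k}) \<longleftrightarrow> (\<exists>k. {j. a j \<noteq> b j} \<subseteq> {k})"
begin

text \<open>Varying coordinate \<open>k\<close> of \<open>a\<close> over \<open>S\<close> traces a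
  line of the graph; the predicate says that \<open>F\<close> maps it injectively into a line of
  direction \<open>p\<close>.\<close>

definition line :: "('m \<Rightarrow> 'p) \<Rightarrow> 'm \<Rightarrow> 'm \<Rightarrow> bool" where
  "line a k p \<longleftrightarrow> (\<forall>v\<in>S. \<forall>w\<in>S. \<forall>j. F (a(k := v)) j = F (a(k := w)) j \<longleftrightarrow> j \<noteq> p \<or> v = w)"

lemma lineD:
  "\<lbrakk>line a k p; v \<in> S; w \<in> S\<rbrakk> \<Longrightarrow> F (a(k := v)) j = F (a(k := w)) j \<longleftrightarrow> j \<noteq> p \<or> v = w"
  by (simp add: line_def)

lemma range_upd: "range a \<subseteq> S \<Longrightarrow> v \<in> S \<Longrightarrow> range (a(k := v)) \<subseteq> S"
  by (auto simp: image_subset_iff)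

lemma upd_adjacent:
  assumes "range a \<subseteq> S" "v \<in> S" "w \<in> S"
  obtains p where "\<And>j. F (a(k := v)) j \<noteq> F (a(k := w)) j \<Longrightarrow> j = p"
proof -
  have "\<exists>p. {j. (a(k := v)) j \<noteq> (a(k := w)) j} \<subseteq> {p}" by (intro exI[of _ k]) auto
  then show thesis
    using adj[OF range_upd range_upd, OF assms(1,2) assms(1,3), of k k] that by auto
qed

lemma upd_inj:
  assumes "range a \<subseteq> S" "v \<in> S" "w \<in> S" "v \<noteq> w"
  obtains j where "F (a(k := v)) j \<noteq> F (a(k := w)) j"
  using inj[OF range_upd range_upd, OF assms(1,2) assms(1,3), of k k] assms(4)
  by (metis ext fun_upd_same)

text \<open>The images of the points of a line are pairwise adjacent, and a clique of a Hamming
  graph lies on one line. Its direction is read off from \<open>x\<close> and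
  \<open>y\<close>.\<close>

lemma ex_line:
  assumes a: "range a \<subseteq> S" and xy: "x \<in> S" "y \<in> S" "x \<noteq> y"
  shows "\<exists>p. line a k p"
proof -
  define G where "G v = F (a(k := v))" for v
  have adjG: "\<exists>p. \<forall>j. G v j \<noteq> G w j \<longrightarrow> j = p" if "v \<in> S" "w \<in> S" for v w
    using upd_adjacent[OF a that] unfolding G_def by metis
  have injG: "\<exists>j. G v j \<noteq> G w j" if "v \<in> S" "w \<in> S" "v \<noteq> w" for v w
    using upd_inj[OF a that] unfolding G_def by metis
  obtain p where p: "G x p \<noteq> G y p" using injG xy by blast
  \<comment> \<open>An image that differs from \<open>G x\<close> in some
    \<open>j \<noteq> p\<close> agrees with it in \<open>p\<close>, so it differs from
    \<open>G y\<close> both in \<open>p\<close> and in \<open>j\<close>.\<close>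
  have off: "G v j = G x j" if "v \<in> S" "j \<noteq> p" for v j
    using adjG[OF that(1) xy(1)] adjG[OF that(1) xy(2)] adjG[OF xy(1,2)] p that(2) by metis
  have "G v j = G w j \<longleftrightarrow> j \<noteq> p \<or> v = w" if "v \<in> S" "w \<in> S" for v w j
    using off[OF that(1)] off[OF that(2)] injG[OF that] by metis
  then show ?thesis unfolding line_def G_def by blast
qed

text \<open>If the images of two parallel lines had different directions \<open>p \<noteq> q\<close>, corresponding points
  would agree in coordinate \<open>p\<close> at most once and in coordinate \<open>q\<close> at most once, so for one of
  three points they would differ in both, although they are adjacent.\<close>

lemma line_upd:
  assumes a: "range a \<subseteq> S" and w: "w \<in> S" and kl: "k \<noteq> l"
    and xyz: "x \<in> S" "y \<in> S" "z \<in> S" "x \<noteq> y" "x \<noteq> z" "y \<noteq> z"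
    and line: "line a k p"
  shows "line (a(l := w)) k p"
proof -
  obtain q where q: "line (a(l := w)) k q"
    using ex_line[OF range_upd[OF a w] xyz(1,2,4)] by blast
  define G where "G v = F (a(k := v))" for v
  define G' where "G' v = F (a(l := w, k := v))" for v
  have G: "G v j = G u j \<longleftrightarrow> j \<noteq> p \<or> v = u" if "v \<in> S" "u \<in> S" for v u j
    unfolding G_def by (rule lineD[OF line that])
  have G': "G' v j = G' u j \<longleftrightarrow> j \<noteq> q \<or> v = u" if "v \<in> S" "u \<in> S" for v u j
    unfolding G'_def by (rule lineD[OF q that])
  have one: "\<exists>r. \<forall>j. G v j \<noteq> G' v j \<longrightarrow> j = r" if "v \<in> S" for v
  proof -
    \<comment> \<open>The two updates commute, so corresponding points of the parallel lines differ
      at most in coordinate \<open>l\<close>.\<close>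
    have "a(k := v) = a(k := v, l := a l)" "a(l := w, k := v) = a(k := v, l := w)"
      using kl by (auto simp: fun_eq_iff)
    moreover have "a l \<in> S" using a by auto
    ultimately show ?thesis
      unfolding G_def G'_def using upd_adjacent[OF range_upd[OF a that] _ w, of "a l" k l] by metis
  qed
  have "p = q"
  proof (rule ccontr)
    assume pq: "p \<noteq> q"
    have "G' x p = G' y p" "G' x p = G' z p" "G x q = G y q" "G x q = G z q"
      using G G' pq xyz by metis+
    moreover have "G x p \<noteq> G y p" "G x p \<noteq> G z p" "G y p \<noteq> G z p"
        "G' x q \<noteq> G' y q" "G' x q \<noteq> G' z q" "G' y q \<noteq> G' z q"
      using G G' pq xyz by metis+
    ultimately show False
      using one[OF xyz(1)] one[OF xyz(2)] one[OF xyz(3)] pq by metis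
  qed
  then show ?thesis using q by simp
qed

text \<open>The directions found at one base tuple hold at every tuple by \<open>line_upd\<close>.
  Hence changing coordinate \<open>l\<close> of a tuple affects only coordinate \<open>p l\<close>
  of its image.\<close>

theorem coordinate_permutation:
  assumes xyz: "x \<in> S" "y \<in> S" "z \<in> S" "x \<noteq> y" "x \<noteq> z" "y \<noteq> z"
  shows "\<exists>p. bij p \<and> (\<forall>a b k. range a \<subseteq> S \<longrightarrow> range b \<subseteq> S \<longrightarrow> a k = b k \<longrightarrow> F a (p k) = F b (p k))"
proof -
  let ?e = "\<lambda>_::'m. x"
  have e: "range ?e \<subseteq> S" using xyz by auto
  have "\<exists>p. \<forall>k. line ?e k (p k)" using ex_line[OF e xyz(1,2,4)] by metis
  then obtain p where p0: "\<And>k. line ?e k (p k)" by blast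
  have p: "line a k (p k)" if a: "range a \<subseteq> S" for a k
  proof (rule change_coordinates_induct[OF e a, of "\<lambda>c. line c k (p k)"])
    show "line ?e k (p k)" by (rule p0)
  next
    fix c l assume c: "range c \<subseteq> S" "line c k (p k)"
    have "a l \<in> S" using a by auto
    \<comment> \<open>For \<open>l = k\<close> the update does not leave the line; otherwise the
      line moves to a parallel one.\<close>
    then show "line (c(l := a l)) k (p k)"
      using line_upd[OF c(1) _ _ xyz c(2)] c(2) by (cases "l = k") (auto simp: line_def)
  qed
  have upd: "F (a(k := v)) j = F a j \<longleftrightarrow> j \<noteq> p k \<or> v = a k"
    if a: "range a \<subseteq> S" and v: "v \<in> S" for a k v j
    using lineD[OF p[OF a] v, of "a k" k j] a by auto
  have "inj p"
  proof (rule injI, rule ccontr)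
    fix k l assume pkl: "p k = p l" and "k \<noteq> l"
    \<comment> \<open>Both images differ from \<open>F ?e\<close> only in the common coordinate, so
      they are adjacent or equal, although the tuples differ in \<open>k\<close> and in
      \<open>l\<close>.\<close>
    have "F (?e(k := y)) j = F (?e(l := y)) j" if "j \<noteq> p k" for j
      using upd[OF e xyz(2), of k j] upd[OF e xyz(2), of l j] that pkl by auto
    then have "\<exists>r. {j. F (?e(k := y)) j \<noteq> F (?e(l := y)) j} \<subseteq> {r}" by blast
    then obtain r where "{j. (?e(k := y)) j \<noteq> (?e(l := y)) j} \<subseteq> {r}"
      using adj[OF range_upd[OF e xyz(2)] range_upd[OF e xyz(2)]] by blast
    moreover have "(?e(k := y)) k \<noteq> (?e(l := y)) k" "(?e(k := y)) l \<noteq> (?e(l := y)) l"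
      using \<open>k \<noteq> l\<close> xyz(4) by auto
    ultimately show False using \<open>k \<noteq> l\<close> by blast
  qed
  then have "bij p" by (simp add: bij_def finite_UNIV_inj_surj)
  moreover have "F a (p k) = F b (p k)"
    if a: "range a \<subseteq> S" and b: "range b \<subseteq> S" and k: "a k = b k" for a b k
  proof (rule sym, rule change_coordinates_induct[OF a b, of "\<lambda>c. F c (p k) = F a (p k)"])
    show "F a (p k) = F a (p k)" ..
  next
    fix c l assume c: "range c \<subseteq> S" "F c (p k) = F a (p k)" and "a l \<noteq> b l"
    \<comment> \<open>A coordinate \<open>l\<close> that changes on the way from \<open>a\<close> to
      \<open>b\<close> is not \<open>k\<close>, so its effect misses \<open>p k\<close>.\<close>
    then have "p k \<noteq> p l" using k \<open>inj p\<close> by (auto dest: injD)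
    moreover have "b l \<in> S" using b by auto
    ultimately show "F (c(l := b l)) (p k) = F a (p k)"
      using upd[OF c(1), of "b l" l "p k"] c(2) by metis
  qed
  ultimately show ?thesis by blast
qed

end

section \<open>Outer products\<close>

lemma outer_prod_nth: "outer_prod \<alpha> $ i = (\<Prod>k\<in>UNIV. \<alpha> k $ i k)"
  by (simp add: outer_prod_def)

text \<open>Distributivity: expanding the product of the sums over single indices gives one sum over
  multi-indices.\<close>

lemma inner_outer_prod:
  "inner (outer_prod \<alpha>) (outer_prod \<beta>) = (\<Prod>k\<in>UNIV. inner (\<alpha> k) (\<beta> k))"
proof -
  have "(\<Prod>k\<in>UNIV. inner (\<alpha> k) (\<beta> k)) = (\<Prod>k\<in>UNIV. \<Sum>i\<in>UNIV. \<alpha> k $ i * \<beta> k $ i)"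
    by (simp add: inner_vec_def)
  also have "\<dots> = (\<Sum>i\<in>UNIV. \<Prod>k\<in>UNIV. \<alpha> k $ i k * \<beta> k $ i k)"
    by (subst prod_sum_PiE) (auto simp: PiE_UNIV_domain)
  finally show ?thesis
    by (simp add: inner_vec_def outer_prod_nth prod.distrib)
qed

lemma outer_prod_eq_0_iff: "outer_prod \<alpha> = 0 \<longleftrightarrow> (\<exists>k. \<alpha> k = 0)"
proof -
  have "outer_prod \<alpha> = 0 \<longleftrightarrow> inner (outer_prod \<alpha>) (outer_prod \<alpha>) = 0" by simp
  also have "\<dots> \<longleftrightarrow> (\<exists>k. \<alpha> k = 0)" unfolding inner_outer_prod by simp
  finally show ?thesis .
qed

lemma outer_prod_upd_nth:
  "outer_prod (\<alpha>(k := x)) $ i = x $ i k * (\<Prod>j\<in>UNIV - {k}. \<alpha> j $ i j)"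
  by (simp add: outer_prod_nth prod.remove[of UNIV k])

lemma outer_prod_upd_add:
  "outer_prod (\<alpha>(k := x + y)) = outer_prod (\<alpha>(k := x)) + outer_prod (\<alpha>(k := y))"
  by (simp add: vec_eq_iff outer_prod_upd_nth algebra_simps)

lemma outer_prod_upd_scaleR:
  "outer_prod (\<alpha>(k := c *\<^sub>R x)) = c *\<^sub>R outer_prod (\<alpha>(k := x))"
  by (simp add: vec_eq_iff outer_prod_upd_nth)

lemma outer_prod_upd_diff:
  "outer_prod (\<alpha>(k := x - y)) = outer_prod (\<alpha>(k := x)) - outer_prod (\<alpha>(k := y))"
  by (simp add: vec_eq_iff outer_prod_upd_nth algebra_simps)

lemma outer_prod_upd_inject:
  assumes "\<And>j. j \<noteq> k \<Longrightarrow> \<alpha> j \<noteq> 0"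
  shows "outer_prod (\<alpha>(k := x)) = outer_prod (\<alpha>(k := y)) \<longleftrightarrow> x = y"
proof
  assume "outer_prod (\<alpha>(k := x)) = outer_prod (\<alpha>(k := y))"
  then have "outer_prod (\<alpha>(k := x - y)) = 0" by (simp add: outer_prod_upd_diff)
  then show "x = y" using assms by (auto simp: outer_prod_eq_0_iff split: if_splits)
qed simp

lemma outer_prod_scale:
  "outer_prod (\<lambda>k. c k *\<^sub>R \<alpha> k) = (\<Prod>k\<in>UNIV. c k) *\<^sub>R outer_prod \<alpha>"
  by (simp add: vec_eq_iff outer_prod_nth prod.distrib)

lemma axis_eq_outer_prod: "axis i 1 = outer_prod (\<lambda>k. axis (i k) 1)"
proof -
  have "(\<Prod>k\<in>UNIV. if j k = i k then 1 else 0) = (if j = i then 1 else (0::real))" for j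
  proof (cases "j = i")
    case False
    then obtain k where "j k \<noteq> i k" by auto
    then have "(\<Prod>k\<in>UNIV. if j k = i k then 1 else (0::real)) = 0" by (intro prod_zero) auto
    then show ?thesis using False by simp
  qed simp
  then show ?thesis by (simp add: vec_eq_iff outer_prod_nth axis_def)
qed

text \<open>The scalar is absorbed into one factor; \<open>undefined\<close> is an arbitrary
  slot.\<close>

lemma scaleR_eq_outer_prod: "\<exists>\<beta>. c *\<^sub>R outer_prod \<alpha> = outer_prod \<beta>"
  using outer_prod_upd_scaleR[of \<alpha> undefined c "\<alpha> undefined"] by (metis fun_upd_triv)

section \<open>Lines spanned by vectors, and vectors that test them\<close>

lemma span_singleton_eqE:
  fixes x y :: "'a::real_vector"
  assumes "span {x} = span {y}" "x \<noteq> 0"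
  obtains c where "c \<noteq> 0" "x = c *\<^sub>R y"
proof -
  have "x \<in> span {y}" using assms(1) span_base by blast
  then show thesis using that assms(2) by (auto simp: span_singleton)
qed

lemma span_singleton_scaleR:
  fixes x :: "'a::real_vector"
  assumes "c \<noteq> 0"
  shows "span {c *\<^sub>R x} = span {x}"
proof
  show "span {c *\<^sub>R x} \<subseteq> span {x}"
    by (intro span_minimal) (auto intro: span_mul span_base)
  have "x = inverse c *\<^sub>R (c *\<^sub>R x)" using assms by simp
  then have "x \<in> span {c *\<^sub>R x}" by (metis span_mul span_base singletonI)
  then show "span {x} \<subseteq> span {c *\<^sub>R x}" by (intro span_minimal) auto
qed

text \<open>The component of \<open>x\<close> orthogonal to \<open>y\<close> does it; it is nonzero
  because \<open>x\<close> is not a multiple of \<open>y\<close>.\<close>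

lemma separating_vector:
  fixes x y :: "'a::real_inner"
  assumes "x \<noteq> 0" "y \<noteq> 0" "span {x} \<noteq> span {y}"
  obtains u where "inner u x \<noteq> 0" "inner u y = 0"
proof -
  define c where "c = inner x y / inner y y"
  define u where "u = x - c *\<^sub>R y"
  have uy: "inner u y = 0" using assms(2) by (simp add: u_def c_def inner_diff_left)
  have "u \<noteq> 0"
  proof
    assume "u = 0"
    then have "x = c *\<^sub>R y" by (simp add: u_def)
    moreover from this have "c \<noteq> 0" using assms(1) by auto
    ultimately show False using span_singleton_scaleR assms(3) by metis
  qed
  moreover have "inner u x = inner u u" using uy by (simp add: u_def inner_diff_right)
  ultimately show thesis by (intro that[OF _ uy]) simp
qed

lemma common_nonorthogonal_vector:
  fixes x y :: "'a::real_inner"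
  assumes "x \<noteq> 0" "y \<noteq> 0"
  obtains u where "inner u x \<noteq> 0" "inner u y \<noteq> 0"
proof (cases "inner x y = 0")
  case True
  then have "inner (x + y) x = inner x x" "inner (x + y) y = inner y y"
    by (simp_all add: inner_add_left inner_commute[of y x])
  then show thesis using that[of "x + y"] assms by simp
next
  case False
  then show thesis using that[of x] assms by simp
qed

section \<open>Proportionality and sums of outer products\<close>

lemma outer_prod_eq_upd:
  assumes \<beta>: "\<And>j. \<beta> j \<noteq> 0" and par: "\<And>j. j \<noteq> k \<Longrightarrow> span {\<alpha> j} = span {\<beta> j}"
  obtains c where "c \<noteq> 0" "outer_prod \<beta> = outer_prod (\<alpha>(k := c *\<^sub>R \<beta> k))"
proof -
  have "\<exists>c. c \<noteq> 0 \<and> \<beta> j = c *\<^sub>R (\<alpha>(k := \<beta> k)) j" for j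
  proof (cases "j = k")
    case True
    then show ?thesis by (intro exI[of _ 1]) auto
  next
    case False
    then show ?thesis using span_singleton_eqE[OF par[OF False, symmetric] \<beta>] by auto
  qed
  then obtain c where c: "\<And>j. c j \<noteq> 0" "\<And>j. \<beta> j = c j *\<^sub>R (\<alpha>(k := \<beta> k)) j" by metis
  have "outer_prod \<beta> = outer_prod (\<lambda>j. c j *\<^sub>R (\<alpha>(k := \<beta> k)) j)" using c(2) by metis
  \<comment> \<open>By multilinearity all proportionality constants are collected in slot
    \<open>k\<close>; slot \<open>k\<close> itself contributes the constant 1 or another nonzero
    one.\<close>
  also have "\<dots> = outer_prod (\<alpha>(k := (\<Prod>j\<in>UNIV. c j) *\<^sub>R \<beta> k))"
    unfolding outer_prod_scale outer_prod_upd_scaleR ..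
  finally show thesis by (rule that[rotated]) (simp add: c(1))
qed

lemma outer_prod_proportional:
  assumes "\<And>j. \<beta> j \<noteq> 0" "\<And>j. span {\<alpha> j} = span {\<beta> j}"
  shows "\<exists>c. outer_prod \<beta> = c *\<^sub>R outer_prod \<alpha>"
proof -
  obtain c where c: "outer_prod \<beta> = outer_prod (\<alpha>(undefined := c *\<^sub>R \<beta> undefined))"
    by (rule outer_prod_eq_upd[OF assms(1), of undefined \<alpha>]) (rule assms(2))
  obtain d where d: "\<beta> undefined = d *\<^sub>R \<alpha> undefined"
    using span_singleton_eqE[OF assms(2)[symmetric] assms(1)] by metis
  have "outer_prod \<beta> = (c * d) *\<^sub>R outer_prod \<alpha>"
    using c outer_prod_upd_scaleR[of \<alpha> undefined "c * d" "\<alpha> undefined"] d by simp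
  then show ?thesis ..
qed

text \<open>If the lines in slot \<open>j\<close> differ, replacing \<open>\<beta> j\<close> by a
  vector orthogonal to \<open>\<alpha> j\<close> but not to \<open>\<beta> j\<close> gives an outer
  product whose pairing vanishes on one tensor and not on the other.\<close>

lemma span_eq_if_outer_prod_proportional:
  assumes \<alpha>: "\<And>j. \<alpha> j \<noteq> 0" and \<beta>: "\<And>j. \<beta> j \<noteq> 0" and eq: "outer_prod \<beta> = c *\<^sub>R outer_prod \<alpha>"
  shows "span {\<alpha> j} = span {\<beta> j}"
proof (rule ccontr)
  assume "span {\<alpha> j} \<noteq> span {\<beta> j}"
  then obtain u where u: "inner u (\<beta> j) \<noteq> 0" "inner u (\<alpha> j) = 0"
    using separating_vector[OF \<beta> \<alpha>] by metis
  have "inner (outer_prod (\<beta>(j := u))) (outer_prod \<beta>) \<noteq> 0"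
    using \<beta> u(1) by (simp add: inner_outer_prod)
  moreover have "inner (outer_prod (\<beta>(j := u))) (outer_prod \<alpha>) = 0"
    unfolding inner_outer_prod using u(2) by (intro prod_zero) auto
  ultimately show False using eq by simp
qed

text \<open>Paired with the four outer products built from dual vectors in two coordinates \<open>p\<close>, \<open>q\<close>
  where the factors differ, \<open>outer_prod \<alpha> + outer_prod \<beta>\<close> gives a nonsingular diagonal 2 by 2 matrix,
  whereas an outer product always gives a singular one.\<close>

lemma outer_prod_add_decomposable_iff:
  assumes \<alpha>: "\<And>j. \<alpha> j \<noteq> 0" and \<beta>: "\<And>j. \<beta> j \<noteq> 0"
  shows "(\<exists>\<gamma>. outer_prod \<alpha> + outer_prod \<beta> = outer_prod \<gamma>) \<longleftrightarrow>
    (\<exists>k. {j. span {\<alpha> j} \<noteq> span {\<beta> j}} \<subseteq> {k})"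
proof
  assume "\<exists>k. {j. span {\<alpha> j} \<noteq> span {\<beta> j}} \<subseteq> {k}"
  then obtain k where "\<And>j. j \<noteq> k \<Longrightarrow> span {\<alpha> j} = span {\<beta> j}" by blast
  then obtain c where "outer_prod \<beta> = outer_prod (\<alpha>(k := c *\<^sub>R \<beta> k))"
    by (rule outer_prod_eq_upd[OF \<beta>, of k \<alpha>])
  then have "outer_prod \<alpha> + outer_prod \<beta> = outer_prod (\<alpha>(k := \<alpha> k + c *\<^sub>R \<beta> k))"
    unfolding outer_prod_upd_add by simp
  then show "\<exists>\<gamma>. outer_prod \<alpha> + outer_prod \<beta> = outer_prod \<gamma>" by blast
next
  assume "\<exists>\<gamma>. outer_prod \<alpha> + outer_prod \<beta> = outer_prod \<gamma>"
  then obtain \<gamma> where \<gamma>: "outer_prod \<alpha> + outer_prod \<beta> = outer_prod \<gamma>" ..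
  have "p = q" if p: "span {\<alpha> p} \<noteq> span {\<beta> p}" and q: "span {\<alpha> q} \<noteq> span {\<beta> q}" for p q
  proof (rule ccontr)
    assume pq: "p \<noteq> q"
    \<comment> \<open>In the slots other than \<open>p\<close> and \<open>q\<close> the test vectors
      must annihilate neither tensor.\<close>
    have "\<exists>u. inner u (\<alpha> j) \<noteq> 0 \<and> inner u (\<beta> j) \<noteq> 0" for j
      using common_nonorthogonal_vector[OF \<alpha> \<beta>] by metis
    then obtain u where u: "\<And>j. inner (u j) (\<alpha> j) \<noteq> 0" "\<And>j. inner (u j) (\<beta> j) \<noteq> 0" by metis
    obtain x where x: "inner x (\<alpha> p) \<noteq> 0" "inner x (\<beta> p) = 0"
      using separating_vector[OF \<alpha> \<beta> p] .
    obtain x' where x': "inner x' (\<beta> p) \<noteq> 0" "inner x' (\<alpha> p) = 0"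
      using separating_vector[OF \<beta> \<alpha> p[symmetric]] .
    obtain y where y: "inner y (\<alpha> q) \<noteq> 0" "inner y (\<beta> q) = 0"
      using separating_vector[OF \<alpha> \<beta> q] .
    obtain y' where y': "inner y' (\<beta> q) \<noteq> 0" "inner y' (\<alpha> q) = 0"
      using separating_vector[OF \<beta> \<alpha> q[symmetric]] .
    define R where "R \<delta> = (\<Prod>j\<in>UNIV - {p} - {q}. inner (u j) (\<delta> j))" for \<delta> :: "'a \<Rightarrow> real^'b"
    define M where "M v w A = inner (outer_prod (u(p := v, q := w))) A" for v w A
    have M: "M v w (outer_prod \<delta>) = inner v (\<delta> p) * inner w (\<delta> q) * R \<delta>" for v w \<delta>
    proof -
      have "(\<Prod>j\<in>UNIV - {p} - {q}. inner ((u(p := v, q := w)) j) (\<delta> j)) = R \<delta>"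
        unfolding R_def by (rule prod.cong) auto
      then show ?thesis
        using pq unfolding M_def inner_outer_prod
        by (subst prod.remove[of UNIV p], simp, simp, subst prod.remove[of _ q]) simp_all
    qed
    have R: "R \<alpha> \<noteq> 0" "R \<beta> \<noteq> 0" using u by (simp_all add: R_def)
    have "M v w (outer_prod \<alpha>) + M v w (outer_prod \<beta>) = M v w (outer_prod \<gamma>)" for v w
      unfolding M_def \<gamma>[symmetric] inner_add_right ..
    note S = this[unfolded M]
    \<comment> \<open>The nonzero diagonal entries make \<open>inner x (\<gamma> p)\<close>,
      \<open>inner y' (\<gamma> q)\<close> and \<open>R \<gamma>\<close> nonzero, but their product
      is an off-diagonal entry.\<close>
    have "inner x (\<gamma> p) * inner y (\<gamma> q) * R \<gamma> \<noteq> 0" "inner x' (\<gamma> p) * inner y' (\<gamma> q) * R \<gamma> \<noteq> 0"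
      using S[of x y] S[of x' y'] x x' y y' R by auto
    moreover have "inner x (\<gamma> p) * inner y' (\<gamma> q) * R \<gamma> = 0"
      using S[of x y'] x y' by simp
    ultimately show False by auto
  qed
  then show "\<exists>k. {j. span {\<alpha> j} \<noteq> span {\<beta> j}} \<subseteq> {k}" by blast
qed

section \<open>Decompositions and rank\<close>

lemma tensor_eq_sum_outer_prod:
  fixes A :: "('m::finite, 'n::finite) tensor"
  obtains R and \<alpha> :: "nat \<Rightarrow> 'm \<Rightarrow> real ^ 'n" where "A = (\<Sum>r<R. outer_prod (\<alpha> r))"
proof -
  obtain h :: "nat \<Rightarrow> 'm \<Rightarrow> 'n" and R where h: "bij_betw h {..<R} UNIV"
    using ex_bij_betw_nat_finite[of "UNIV :: ('m \<Rightarrow> 'n) set"] by (metis atLeast0LessThan finite)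
  have "\<exists>\<beta> :: 'm \<Rightarrow> real ^ 'n. A $ i *\<^sub>R axis i 1 = outer_prod \<beta>" for i
    unfolding axis_eq_outer_prod by (rule scaleR_eq_outer_prod)
  then obtain \<beta> :: "('m \<Rightarrow> 'n) \<Rightarrow> 'm \<Rightarrow> real ^ 'n"
    where \<beta>: "\<And>i. A $ i *\<^sub>R axis i 1 = outer_prod (\<beta> i)" by metis
  have "A = (\<Sum>i\<in>UNIV. A $ i *\<^sub>R axis i 1)"
    using basis_expansion[of A] by (simp add: scalar_mult_eq_scaleR)
  also have "\<dots> = (\<Sum>r<R. outer_prod (\<beta> (h r)))"
    unfolding \<beta> by (rule sum.reindex_bij_betw[OF h, symmetric])
  finally show thesis by (rule that)
qed

text \<open>The basis expansion supplies an admissible length, so the minimum in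
  \<open>cp_rank\<close> is attained.\<close>

lemma cp_rank_decomposition:
  fixes A :: "('m::finite, 'n::finite) tensor"
  obtains \<alpha> :: "nat \<Rightarrow> 'm \<Rightarrow> real ^ 'n" where "A = (\<Sum>r<cp_rank A. outer_prod (\<alpha> r))"
proof -
  have "\<exists>R. \<exists>\<alpha> :: nat \<Rightarrow> 'm \<Rightarrow> real ^ 'n. A = (\<Sum>r<R. outer_prod (\<alpha> r))"
    using tensor_eq_sum_outer_prod[of A] by metis
  from LeastI_ex[OF this] show thesis using that unfolding cp_rank_def by blast
qed

text \<open>The bound is an inequality because an outer product with a zero factor is the zero
  tensor, of rank 0.\<close>

lemma cp_rank_le_1_iff: "cp_rank A \<le> 1 \<longleftrightarrow> (\<exists>\<alpha>. A = outer_prod \<alpha>)"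
proof
  assume le: "cp_rank A \<le> 1"
  obtain \<alpha> where \<alpha>: "A = (\<Sum>r<cp_rank A. outer_prod (\<alpha> r))" by (rule cp_rank_decomposition)
  show "\<exists>\<alpha>. A = outer_prod \<alpha>"
  proof (cases "cp_rank A = 0")
    case True
    then have "A = outer_prod (\<lambda>_. 0)" using \<alpha> outer_prod_eq_0_iff[of "\<lambda>_. 0"] by simp
    then show ?thesis by blast
  next
    case False
    then have "cp_rank A = Suc 0" using le by simp
    then have "A = outer_prod (\<alpha> 0)" using \<alpha> by simp
    then show ?thesis by blast
  qed
next
  assume "\<exists>\<alpha>. A = outer_prod \<alpha>"
  then obtain \<alpha> where "A = (\<Sum>r<1::nat. outer_prod ((\<lambda>_. \<alpha>) r))" by auto
  then show "cp_rank A \<le> 1" unfolding cp_rank_def by (intro Least_le exI[of _ "\<lambda>_. \<alpha>"])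
qed

section \<open>The action of the tensor form\<close>

lemma vector_perm_tensor:
  assumes "bij \<tau>"
  shows "C v* perm_tensor \<tau> = (\<chi> i. C $ (i \<circ> inv \<tau>))"
proof -
  \<comment> \<open>Here \<open>j\<close> is the summation index and \<open>i\<close> the free one;
    solving for \<open>j\<close> leaves a single term and introduces the inverse.\<close>
  have "(\<forall>k. i k = j (\<tau> k)) \<longleftrightarrow> j = i \<circ> inv \<tau>" for i j :: "'a \<Rightarrow> 'b"
    using assms by (auto simp: fun_eq_iff bij_is_surj surj_f_inv_f bij_is_inj inv_f_f)
  then show ?thesis
    by (simp add: vec_eq_iff vector_matrix_mult_def perm_tensor_def if_distrib cong: if_cong)
qed

text \<open>Distributivity lets each matrix act on its own factor. Reindexing the product by
  \<open>\<tau>\<close> then turns the inverse on multi-indices into \<open>\<tau>\<close> on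
  factors.\<close>

lemma tensor_form_outer_prod:
  assumes "bij \<tau>"
  shows "(matrix_outer_prod B *v outer_prod \<alpha>) v* perm_tensor \<tau> =
    outer_prod (\<lambda>k. B (\<tau> k) *v \<alpha> (\<tau> k))"
proof -
  have "matrix_outer_prod B *v outer_prod \<alpha> = outer_prod (\<lambda>k. B k *v \<alpha> k)"
  proof -
    have "(\<Prod>k\<in>UNIV. (B k *v \<alpha> k) $ i k) = (\<Prod>k\<in>UNIV. \<Sum>j\<in>UNIV. B k $ i k $ j * \<alpha> k $ j)" for i
      by (simp add: matrix_vector_mult_def)
    also have "\<dots> i = (\<Sum>j\<in>UNIV. \<Prod>k\<in>UNIV. B k $ i k $ j k * \<alpha> k $ j k)" for i
      by (subst prod_sum_PiE) (auto simp: PiE_UNIV_domain)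
    finally show ?thesis
      by (simp add: vec_eq_iff outer_prod_nth matrix_vector_mult_def matrix_outer_prod_def prod.distrib)
  qed
  moreover have "(\<Prod>k\<in>UNIV. (B k *v \<alpha> k) $ i (inv \<tau> k)) =
      (\<Prod>k\<in>UNIV. (B (\<tau> k) *v \<alpha> (\<tau> k)) $ i k)" for i
    using prod.reindex_bij_betw[OF assms, of "\<lambda>k. (B k *v \<alpha> k) $ i (inv \<tau> k)"] assms
    by (simp add: bij_is_inj inv_f_f)
  ultimately show ?thesis
    by (simp add: vector_perm_tensor[OF assms] vec_eq_iff outer_prod_nth)
qed

lemma linear_eq_if_eq_on_outer_prod:
  assumes "linear \<phi>" "linear \<psi>" "\<And>\<alpha>. \<phi> (outer_prod \<alpha>) = \<psi> (outer_prod \<alpha>)"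
  shows "\<phi> A = \<psi> A"
proof -
  obtain R \<alpha> where "A = (\<Sum>r<(R::nat). outer_prod (\<alpha> r))" by (rule tensor_eq_sum_outer_prod)
  then show ?thesis using assms by (simp add: linear_sum)
qed

section \<open>Preservers of outer products\<close>

text \<open>This is what rank preservation says about tensors of rank at most 1.\<close>

locale decomposable_preserver =
  fixes T :: "('m::finite, 'n::finite) tensor \<Rightarrow> ('m, 'n) tensor"
  assumes linear: "linear T" and inj: "inj T"
    and decomposable_iff: "(\<exists>\<beta>. T A = outer_prod \<beta>) \<longleftrightarrow> (\<exists>\<alpha>. A = outer_prod \<alpha>)"
begin

text \<open>Factors of a nonzero outer product are determined only up to scalars, so comparisons
  between them are made on spans.\<close>

definition factors :: "('m \<Rightarrow> real ^ 'n) \<Rightarrow> 'm \<Rightarrow> real ^ 'n" where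
  "factors \<alpha> = (SOME \<beta>. T (outer_prod \<alpha>) = outer_prod \<beta>)"

lemma T_outer_prod: "T (outer_prod \<alpha>) = outer_prod (factors \<alpha>)"
  unfolding factors_def using decomposable_iff by (metis (mono_tags, lifting) someI_ex)

lemma factors_nonzero: "(\<And>j. \<alpha> j \<noteq> 0) \<Longrightarrow> factors \<alpha> j \<noteq> 0"
  using T_outer_prod[of \<alpha>] linear_injective_0[OF linear] inj outer_prod_eq_0_iff by metis

text \<open>Equal lines in all slots amount to proportional outer products, and an injective linear
  map preserves and reflects proportionality with the same constant.\<close>

lemma factors_proportional_iff:
  assumes \<alpha>: "\<And>j. \<alpha> j \<noteq> 0" and \<beta>: "\<And>j. \<beta> j \<noteq> 0"
  shows "(\<forall>j. span {factors \<alpha> j} = span {factors \<beta> j}) \<longleftrightarrow> (\<forall>j. span {\<alpha> j} = span {\<beta> j})"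
proof -
  have *: "(\<forall>j. span {\<alpha> j} = span {\<beta> j}) \<longleftrightarrow> (\<exists>c. outer_prod \<beta> = c *\<^sub>R outer_prod \<alpha>)"
    if "\<And>j. \<alpha> j \<noteq> 0" "\<And>j. \<beta> j \<noteq> 0" for \<alpha> \<beta> :: "'m \<Rightarrow> real ^ 'n"
  proof
    assume "\<forall>j. span {\<alpha> j} = span {\<beta> j}"
    then show "\<exists>c. outer_prod \<beta> = c *\<^sub>R outer_prod \<alpha>"
      by (intro outer_prod_proportional[OF that(2)]) simp
  next
    assume "\<exists>c. outer_prod \<beta> = c *\<^sub>R outer_prod \<alpha>"
    then show "\<forall>j. span {\<alpha> j} = span {\<beta> j}"
      using span_eq_if_outer_prod_proportional[of \<alpha> \<beta>] that by blast
  qed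
  have "outer_prod (factors \<beta>) = c *\<^sub>R outer_prod (factors \<alpha>) \<longleftrightarrow>
      outer_prod \<beta> = c *\<^sub>R outer_prod \<alpha>" for c
    unfolding T_outer_prod[symmetric] linear_cmul[OF linear, symmetric] inj_eq[OF inj] ..
  then show ?thesis using *[of \<alpha> \<beta>] *[of "factors \<alpha>" "factors \<beta>"] factors_nonzero \<alpha> \<beta> by simp
qed

text \<open>Adjacency is decomposability of the sum, which \<open>T\<close> preserves and
  reflects.\<close>

lemma factors_adjacent_iff:
  assumes \<alpha>: "\<And>j. \<alpha> j \<noteq> 0" and \<beta>: "\<And>j. \<beta> j \<noteq> 0"
  shows "(\<exists>k. {j. span {factors \<alpha> j} \<noteq> span {factors \<beta> j}} \<subseteq> {k}) \<longleftrightarrow>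
    (\<exists>k. {j. span {\<alpha> j} \<noteq> span {\<beta> j}} \<subseteq> {k})"
  using decomposable_iff[of "outer_prod \<alpha> + outer_prod \<beta>"]
  unfolding linear_add[OF linear] T_outer_prod
    outer_prod_add_decomposable_iff[of \<alpha> \<beta>, OF \<alpha> \<beta>]
    outer_prod_add_decomposable_iff[of "factors \<alpha>" "factors \<beta>",
      OF factors_nonzero[of \<alpha>, OF \<alpha>] factors_nonzero[of \<beta>, OF \<beta>]] .

lemma factor_permutation:
  "\<exists>p. bij p \<and> (\<forall>\<alpha> \<beta> k. (\<forall>j. \<alpha> j \<noteq> 0) \<longrightarrow> (\<forall>j. \<beta> j \<noteq> 0) \<longrightarrow> span {\<alpha> k} = span {\<beta> k} \<longrightarrow>
      span {factors \<alpha> (p k)} = span {factors \<beta> (p k)})"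
proof (cases "\<exists>x y :: real ^ 'n. x \<noteq> 0 \<and> y \<noteq> 0 \<and> span {x} \<noteq> span {y}")
  \<comment> \<open>There is only one line, so all nonzero factors in a slot have the same
    span.\<close>
  case False
  then have eq: "span {factors \<alpha> j} = span {factors \<beta> j}"
    if "\<forall>j. \<alpha> j \<noteq> 0" "\<forall>j. \<beta> j \<noteq> 0" for \<alpha> \<beta> j
    using factors_nonzero[of \<alpha> j] factors_nonzero[of \<beta> j] that by metis
  show ?thesis by (intro exI[of _ id] conjI bij_id allI impI) (rule eq)
next
  case True
  then obtain x y :: "real ^ 'n" where xy: "x \<noteq> 0" "y \<noteq> 0" "span {x} \<noteq> span {y}" by blast
  \<comment> \<open>The sum of two independent vectors spans a third line, as
    \<open>coordinate_permutation\<close> asks for three points.\<close>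
  have sum: "u + v \<noteq> 0 \<and> span {u + v} \<noteq> span {u}"
    if "u \<noteq> 0" "v \<noteq> 0" "span {u} \<noteq> span {v}" for u v :: "real ^ 'n"
  proof -
    have "u + v \<notin> span {u}"
    proof
      assume "u + v \<in> span {u}"
      then have "(u + v) - u \<in> span {u}" by (intro span_diff) (auto intro: span_base)
      then obtain c where "v = c *\<^sub>R u" by (auto simp: span_singleton)
      then show False using that span_singleton_scaleR[of c u] by auto
    qed
    then show ?thesis by (metis span_base span_zero singletonI)
  qed
  \<comment> \<open>\<open>S\<close> is the projective space, \<open>rep\<close> picks a vector on
    each line, and \<open>F\<close> is the map that \<open>T\<close> induces on tuples of
    points.\<close>
  define S where "S = (\<lambda>v :: real ^ 'n. span {v}) ` (- {0})"
  define rep where "rep P = (SOME v :: real ^ 'n. v \<noteq> 0 \<and> span {v} = P)" for P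
  define F where "F a = (\<lambda>j. span {factors (\<lambda>k. rep (a k)) j})" for a
  have rep: "rep P \<noteq> 0 \<and> span {rep P} = P" if "P \<in> S" for P
    unfolding rep_def using that by (intro someI_ex[of "\<lambda>v. v \<noteq> 0 \<and> span {v} = P"]) (auto simp: S_def)
  have nz: "rep (a k) \<noteq> 0" "span {rep (a k)} = a k" if "range a \<subseteq> S" for a :: "'m \<Rightarrow> _" and k
    using rep that by auto
  interpret hamming_automorphism S F
  proof
    fix a b :: "'m \<Rightarrow> (real ^ 'n) set"
    assume ab: "range a \<subseteq> S" "range b \<subseteq> S"
    show "(\<exists>k. {j. F a j \<noteq> F b j} \<subseteq> {k}) \<longleftrightarrow> (\<exists>k. {j. a j \<noteq> b j} \<subseteq> {k})"
      using factors_adjacent_iff[OF nz(1) nz(1), OF ab] nz(2)[OF ab(1)] nz(2)[OF ab(2)]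
      unfolding F_def by simp
    assume "F a = F b"
    then show "a = b"
      using factors_proportional_iff[OF nz(1) nz(1), OF ab] nz(2)[OF ab(1)] nz(2)[OF ab(2)]
      unfolding F_def by (simp add: fun_eq_iff)
  qed
  have "span {x} \<in> S" "span {y} \<in> S" "span {x + y} \<in> S"
    "span {x} \<noteq> span {y}" "span {x} \<noteq> span {x + y}" "span {y} \<noteq> span {x + y}"
    using xy sum[OF xy] sum[OF xy(2,1) xy(3)[symmetric]] unfolding S_def by (auto simp: add.commute)
  then obtain p where p: "bij p"
    "\<And>a b k. \<lbrakk>range a \<subseteq> S; range b \<subseteq> S; a k = b k\<rbrakk> \<Longrightarrow> F a (p k) = F b (p k)"
    using coordinate_permutation[of "span {x}" "span {y}" "span {x + y}"] by blast
  \<comment> \<open>The induced map does not depend on the representatives, by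
    \<open>factors_proportional_iff\<close>.\<close>
  have F: "F (\<lambda>k. span {\<alpha> k}) j = span {factors \<alpha> j}" and S: "range (\<lambda>k. span {\<alpha> k}) \<subseteq> S"
    if "\<And>j. \<alpha> j \<noteq> 0" for \<alpha> j
  proof -
    show S: "range (\<lambda>k. span {\<alpha> k}) \<subseteq> S" using that by (auto simp: S_def)
    show "F (\<lambda>k. span {\<alpha> k}) j = span {factors \<alpha> j}"
      unfolding F_def 
      using factors_proportional_iff[of "\<lambda>k. rep (span {\<alpha> k})" \<alpha>] nz[OF S] that by simp
  qed
  show ?thesis
  proof (intro exI[of _ p] conjI allI impI p(1))
    fix \<alpha> \<beta> :: "'m \<Rightarrow> real ^ 'n" and k
    assume "\<forall>j. \<alpha> j \<noteq> 0" "\<forall>j. \<beta> j \<noteq> 0" "span {\<alpha> k} = span {\<beta> k}"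
    then show "span {factors \<alpha> (p k)} = span {factors \<beta> (p k)}"
      using p(2)[OF S S, of \<alpha> \<beta> k] F[of \<alpha>] F[of \<beta>] by simp
  qed
qed

text \<open>Source slot \<open>k\<close> feeds target slot \<open>p k\<close>, so target slot
  \<open>j\<close> reads source slot \<open>inv p j\<close>.\<close>

lemma factorwise_linear:
  obtains C :: "'m \<Rightarrow> real ^ 'n \<Rightarrow> real ^ 'n" and p
  where "bij p" "\<And>k. linear (C k)" "\<And>k. inj (C k)"
    "\<And>\<alpha>. T (outer_prod \<alpha>) = outer_prod (\<lambda>j. C (inv p j) (\<alpha> (inv p j)))"
proof -
  obtain p where p: "bij p"
    and par: "\<And>\<alpha> \<beta> k. \<lbrakk>\<forall>j. \<alpha> j \<noteq> 0; \<forall>j. \<beta> j \<noteq> 0; span {\<alpha> k} = span {\<beta> k}\<rbrakk> \<Longrightarrow>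
      span {factors \<alpha> (p k)} = span {factors \<beta> (p k)}"
    using factor_permutation by blast
  have inv_p: "inv p (p k) = k" "p (inv p j) = j" for j k
    using p by (simp_all add: bij_is_inj bij_is_surj inv_f_f surj_f_inv_f)
  \<comment> \<open>The base tuple; what matters is that no factor vanishes.\<close>
  define a :: "'m \<Rightarrow> real ^ 'n" where "a = (\<lambda>_. axis undefined 1)"
  have a: "a j \<noteq> 0" for j by (simp add: a_def axis_eq_0_iff)
  define b where "b = factors a"
  have b: "b j \<noteq> 0" for j unfolding b_def using a by (rule factors_nonzero)
  \<comment> \<open>Moving slot \<open>k\<close> keeps the lines in all slots but
    \<open>p k\<close>, so the scalars can be gathered there. The zero vector is separate, since
    spans of factors are controlled only for nonzero tuples.\<close>
  have "\<exists>x. T (outer_prod (a(k := v))) = outer_prod (b(p k := x)) \<and>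
      (v \<noteq> 0 \<longrightarrow> span {x} = span {factors (a(k := v)) (p k)})" for k v
  proof (cases "v = 0")
    case True
    then have "outer_prod (a(k := v)) = 0" "outer_prod (b(p k := 0)) = 0"
      by (auto simp: outer_prod_eq_0_iff intro: exI[of _ "p k"])
    then show ?thesis using True linear_0[OF linear] by auto
  next
    case False
    let ?\<beta> = "factors (a(k := v))"
    have av: "(a(k := v)) j \<noteq> 0" for j using a False by simp
    have "span {b j} = span {?\<beta> j}" if "j \<noteq> p k" for j
    proof -
      have "inv p j \<noteq> k" using that inv_p by metis
      then show ?thesis using par[of a "a(k := v)" "inv p j"] a av inv_p by (simp add: b_def)
    qed
    then obtain c where "c \<noteq> 0" "outer_prod ?\<beta> = outer_prod (b(p k := c *\<^sub>R ?\<beta> (p k)))"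
      by (rule outer_prod_eq_upd[OF factors_nonzero[OF av], of "p k" b])
    then show ?thesis using T_outer_prod span_singleton_scaleR by metis
  qed
  then obtain C where
    C: "\<And>k v. T (outer_prod (a(k := v))) = outer_prod (b(p k := C k v))" and
    C_span: "\<And>k v. v \<noteq> 0 \<Longrightarrow> span {C k v} = span {factors (a(k := v)) (p k)}" by metis
  have b_inject: "outer_prod (b(k := x)) = outer_prod (b(k := y)) \<longleftrightarrow> x = y" for k x y
    by (rule outer_prod_upd_inject) (rule b)
  have lin: "linear (C k)" for k
  \<comment> \<open>\<open>C k v\<close> is the unique vector that fits in slot \<open>p k\<close>
    of \<open>b\<close>, so linearity of \<open>T\<close> in slot \<open>k\<close> passes to
    \<open>C k\<close>.\<close>
  proof (rule linearI)
    show "C k (x + y) = C k x + C k y" for x y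
      using b_inject C outer_prod_upd_add linear_add[OF linear] by metis
    show "C k (r *\<^sub>R x) = r *\<^sub>R C k x" for r x
      using b_inject C outer_prod_upd_scaleR linear_cmul[OF linear] by metis
  qed
  have injC: "inj (C k)" for k
  proof (rule injI)
    fix x y assume "C k x = C k y"
    then have "outer_prod (a(k := x)) = outer_prod (a(k := y))" using C inj by (metis injD)
    then show "x = y" using outer_prod_upd_inject a by metis
  qed
  define h where "h \<alpha> = (\<lambda>j. C (inv p j) (\<alpha> (inv p j)))" for \<alpha>
  have C0: "C k v = 0 \<longleftrightarrow> v = 0" for k v
    using linear_injective_0[OF lin] injC linear_0[OF lin] by metis
  have h_nz: "h \<alpha> j \<noteq> 0" if "\<And>j. \<alpha> j \<noteq> 0" for \<alpha> j using that by (simp add: h_def C0)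
  have h_upd: "h (\<alpha>(k := v)) = (h \<alpha>)(p k := C k v)" for \<alpha> k v
    using inv_p by (auto simp: h_def fun_eq_iff)
  \<comment> \<open>The line in slot \<open>j\<close> depends only on source slot
    \<open>inv p j\<close>, so the other slots may be reset to the base tuple.\<close>
  have h_span: "span {h \<alpha> j} = span {factors \<alpha> j}" if \<alpha>: "\<And>j. \<alpha> j \<noteq> 0" for \<alpha> j
    using par[of "a(inv p j := \<alpha> (inv p j))" \<alpha> "inv p j"] C_span[OF \<alpha>] a \<alpha> inv_p by (simp add: h_def)
  have scal: "\<exists>c. T (outer_prod \<alpha>) = c *\<^sub>R outer_prod (h \<alpha>)" if \<alpha>: "\<And>j. \<alpha> j \<noteq> 0" for \<alpha>
    unfolding T_outer_prod by (rule outer_prod_proportional[OF factors_nonzero[OF \<alpha>] h_span[OF \<alpha>]])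
  have step: "T (outer_prod (\<alpha>(l := v))) = outer_prod (h (\<alpha>(l := v)))"
    if \<alpha>: "\<And>j. \<alpha> j \<noteq> 0" and v: "v \<noteq> 0" and IH: "T (outer_prod \<alpha>) = outer_prod (h \<alpha>)" for \<alpha> l v
  proof (cases "span {v} = span {\<alpha> l}")
    case True
    then obtain s where s: "v = s *\<^sub>R \<alpha> l" using span_singleton_eqE v by metis
    have "outer_prod (h (\<alpha>(l := v))) = s *\<^sub>R outer_prod ((h \<alpha>)(p l := C l (\<alpha> l)))"
      unfolding h_upd s linear_cmul[OF lin] by (rule outer_prod_upd_scaleR)
    also have "\<dots> = s *\<^sub>R T (outer_prod \<alpha>)" unfolding h_upd[symmetric] IH by simp
    also have "\<dots> = T (outer_prod (\<alpha>(l := v)))"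
      unfolding s outer_prod_upd_scaleR linear_cmul[OF linear] by simp
    finally show ?thesis ..
  next
    case False
    define H where "H x = outer_prod ((h \<alpha>)(p l := x))" for x
    have H_inject: "H x = H y \<longleftrightarrow> x = y" for x y
      unfolding H_def by (rule outer_prod_upd_inject) (rule h_nz[OF \<alpha>])
    \<comment> \<open>This lets \<open>scal\<close> apply to the tuple with
      \<open>\<alpha> l + v\<close> in slot \<open>l\<close>.\<close>
    have "\<alpha> l + v \<noteq> 0"
    proof
      assume "\<alpha> l + v = 0"
      then have "v = (-1) *\<^sub>R \<alpha> l" by (simp add: add_eq_0_iff)
      then show False using False span_singleton_scaleR[of "-1" "\<alpha> l"] by simp
    qed
    then obtain d where d: "T (outer_prod (\<alpha>(l := \<alpha> l + v))) = d *\<^sub>R H (C l (\<alpha> l + v))"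
      using scal[of "\<alpha>(l := \<alpha> l + v)"] \<alpha> unfolding h_upd H_def by (metis fun_upd_apply)
    obtain c where c: "T (outer_prod (\<alpha>(l := v))) = c *\<^sub>R H (C l v)"
      using scal[of "\<alpha>(l := v)"] \<alpha> v unfolding h_upd H_def by (metis fun_upd_apply)
    have IH': "T (outer_prod (\<alpha>(l := \<alpha> l))) = H (C l (\<alpha> l))"
      using IH unfolding H_def h_upd[symmetric] by simp
    \<comment> \<open>Additivity in slot \<open>l\<close> links the unknown scalars \<open>d\<close>
      and \<open>c\<close> to the scalar 1 known at \<open>\<alpha> l\<close>; independence of
      \<open>\<alpha> l\<close> and \<open>v\<close> then forces \<open>d = c = 1\<close>.\<close>
    have "d *\<^sub>R H (C l (\<alpha> l + v)) = H (C l (\<alpha> l)) + c *\<^sub>R H (C l v)"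
      using d unfolding outer_prod_upd_add linear_add[OF linear] c IH' by simp
    then have "H (C l (d *\<^sub>R (\<alpha> l + v))) = H (C l (\<alpha> l + c *\<^sub>R v))"
      unfolding linear_add[OF lin] linear_cmul[OF lin] H_def outer_prod_upd_add outer_prod_upd_scaleR .
    then have "d *\<^sub>R (\<alpha> l + v) = \<alpha> l + c *\<^sub>R v" using H_inject injC by (metis injD)
    then have eq: "(d - c) *\<^sub>R v = (1 - d) *\<^sub>R \<alpha> l" by (simp add: algebra_simps)
    have "d = c"
    proof (rule ccontr)
      assume "d \<noteq> c"
      then have "v = ((1 - d) / (d - c)) *\<^sub>R \<alpha> l"
        using arg_cong[OF eq, of "\<lambda>x. (1 / (d - c)) *\<^sub>R x"] by simp
      moreover from this v have "(1 - d) / (d - c) \<noteq> 0" by (metis scaleR_zero_left)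
      ultimately show False using False span_singleton_scaleR by metis
    qed
    then have "c = 1" using eq \<alpha>[of l] by simp
    then show ?thesis using c unfolding H_def h_upd by simp
  qed
  have base: "T (outer_prod a) = outer_prod (h a)"
  proof -
    \<comment> \<open>Writing \<open>a k\<close> back into slot \<open>k\<close> leaves
      \<open>a\<close> unchanged, so uniqueness identifies the entry with that of
      \<open>b\<close>.\<close>
    have "C k (a k) = b (p k)" for k
      using C[of k "a k"] T_outer_prod[of a] b_inject[of "p k" "C k (a k)" "b (p k)"]
      by (simp add: b_def)
    then have "h a = b" using inv_p by (simp add: h_def fun_eq_iff)
    then show ?thesis using T_outer_prod b_def by simp
  qed
  have "T (outer_prod \<alpha>) = outer_prod (h \<alpha>)" for \<alpha>
  proof (cases "\<forall>j. \<alpha> j \<noteq> 0")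
    case True
    show ?thesis
    proof (rule change_coordinates_induct[where S = "- {0}" and a = a and b = \<alpha>])
      show "range a \<subseteq> - {0}" "range \<alpha> \<subseteq> - {0}" using a True by auto
      show "T (outer_prod a) = outer_prod (h a)" by (rule base)
      fix c l
      assume c: "range c \<subseteq> - {0}" and IH: "T (outer_prod c) = outer_prod (h c)"
      have "c j \<noteq> 0" for j using c by auto
      then show "T (outer_prod (c(l := \<alpha> l))) = outer_prod (h (c(l := \<alpha> l)))"
        using True IH by (intro step) auto
    qed
  next
    case False
    then obtain k where "\<alpha> k = 0" by auto
    then have "outer_prod \<alpha> = 0" "h \<alpha> (p k) = 0" by (auto simp: outer_prod_eq_0_iff h_def inv_p C0)
    then show ?thesis using linear_0[OF linear] outer_prod_eq_0_iff[of "h \<alpha>"] by auto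
  qed
  then show thesis unfolding h_def by (rule that[of p C, OF p lin injC])
qed

end

section \<open>The normal form of rank preservers\<close>

theorem theorem4p8:
  fixes \<phi> :: "('m::finite, 'n::finite) tensor \<Rightarrow> ('m, 'n) tensor"
  assumes "linear \<phi>" and "bij \<phi>"
  shows "rank_preserver \<phi> \<longleftrightarrow>
    (\<exists>(B :: 'm \<Rightarrow> real ^ 'n ^ 'n) (\<tau> :: 'm \<Rightarrow> 'm).
      (\<forall>k. invertible (B k)) \<and> \<tau> permutes UNIV \<and>
      (\<forall>A. \<phi> A = (matrix_outer_prod B *v A) v* perm_tensor \<tau>))"
proof
  assume rank: "rank_preserver \<phi>"
  interpret decomposable_preserver \<phi>
  proof (rule decomposable_preserver.intro)
    show "linear \<phi>" "inj \<phi>" using assms by (auto simp: bij_is_inj)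
    show "(\<exists>\<beta>. \<phi> A = outer_prod \<beta>) \<longleftrightarrow> (\<exists>\<alpha>. A = outer_prod \<alpha>)" for A
      using rank cp_rank_le_1_iff unfolding rank_preserver_def by metis
  qed
  obtain C :: "'m \<Rightarrow> real ^ 'n \<Rightarrow> real ^ 'n" and p where
    p: "bij p" and C: "\<And>k. linear (C k)" "\<And>k. inj (C k)" and
    \<phi>: "\<And>\<alpha>. \<phi> (outer_prod \<alpha>) = outer_prod (\<lambda>j. C (inv p j) (\<alpha> (inv p j)))"
    by (rule factorwise_linear) blast
  define B where "B k = matrix (C k)" for k
  have B: "B k *v v = C k v" for k v unfolding B_def 
    using matrix_vector_mul(2)[of "C k"] C(1)[of k] by metis
  have bij: "bij (inv p)" using p by (rule bij_imp_bij_inv)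
  have "invertible (B k)" for k
    using C(2)[of k] unfolding invertible_left_inverse matrix_left_invertible_injective
    by (simp add: inj_def B)
  \<comment> \<open>The tensor form with \<open>\<tau>\<close> puts source slot
    \<open>\<tau> k\<close> into target slot \<open>k\<close>, whence
    \<open>\<tau> = inv p\<close>.\<close>
  moreover have "\<phi> A = (matrix_outer_prod B *v A) v* perm_tensor (inv p)" for A
  proof (rule linear_eq_if_eq_on_outer_prod[OF assms(1)])
    show "linear (\<lambda>A. (matrix_outer_prod B *v A) v* (perm_tensor (inv p) :: ('m, 'n) tensor2))"
      unfolding transpose_matrix_vector[symmetric]
      by (rule linear_compose[OF matrix_vector_mul_linear matrix_vector_mul_linear, unfolded o_def])
    show "\<phi> (outer_prod \<alpha>) = (matrix_outer_prod B *v outer_prod \<alpha>) v* perm_tensor (inv p)" for \<alpha>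
      unfolding tensor_form_outer_prod[OF bij] B \<phi> ..
  qed
  moreover have "inv p permutes UNIV" using bij by (auto intro: bij_imp_permutes)
  ultimately show "\<exists>(B :: 'm \<Rightarrow> real ^ 'n ^ 'n) (\<tau> :: 'm \<Rightarrow> 'm).
      (\<forall>k. invertible (B k)) \<and> \<tau> permutes UNIV \<and>
      (\<forall>A. \<phi> A = (matrix_outer_prod B *v A) v* perm_tensor \<tau>)" by blast
next
  assume "\<exists>(B :: 'm \<Rightarrow> real ^ 'n ^ 'n) (\<tau> :: 'm \<Rightarrow> 'm).
      (\<forall>k. invertible (B k)) \<and> \<tau> permutes UNIV \<and>
      (\<forall>A. \<phi> A = (matrix_outer_prod B *v A) v* perm_tensor \<tau>)"
  then obtain B :: "'m \<Rightarrow> real ^ 'n ^ 'n" and \<tau> :: "'m \<Rightarrow> 'm" where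
    inv: "\<And>k. invertible (B k)" and "\<tau> permutes UNIV" and
    form: "\<And>A. \<phi> A = (matrix_outer_prod B *v A) v* perm_tensor \<tau>" by blast
  then have \<tau>: "bij \<tau>" by (simp add: permutes_imp_bij)
  have \<phi>: "\<phi> (outer_prod \<alpha>) = outer_prod (\<lambda>k. B (\<tau> k) *v \<alpha> (\<tau> k))" for \<alpha>
    unfolding form by (rule tensor_form_outer_prod[OF \<tau>])
  \<comment> \<open>Inverse matrices and the inverse permutation pull back the factors of any outer
    product.\<close>
  have onto: "\<exists>\<alpha>. \<phi> (outer_prod \<alpha>) = outer_prod \<beta>" for \<beta>
  proof -
    obtain B' where B': "\<And>k. B k ** B' k = mat 1" using inv unfolding invertible_def by metis
    have "B (\<tau> k) *v (B' (\<tau> k) *v \<beta> (inv \<tau> (\<tau> k))) = \<beta> k" for k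
      using B' \<tau> by (simp add: matrix_vector_mul_assoc bij_is_inj inv_f_f)
    then have "\<phi> (outer_prod (\<lambda>k. B' k *v \<beta> (inv \<tau> k))) = outer_prod \<beta>"
      unfolding \<phi> by simp
    then show ?thesis by blast
  qed
  \<comment> \<open>For each length \<open>R\<close>, decompositions push forward termwise and pull
    back by \<open>onto\<close> and injectivity. The two ranks are thus minima of the same
    set.\<close>
  have "(\<exists>\<alpha> :: nat \<Rightarrow> 'm \<Rightarrow> real ^ 'n. \<phi> A = (\<Sum>r<R. outer_prod (\<alpha> r))) \<longleftrightarrow>
      (\<exists>\<alpha> :: nat \<Rightarrow> 'm \<Rightarrow> real ^ 'n. A = (\<Sum>r<R. outer_prod (\<alpha> r)))" for A and R :: nat
  proof
    assume "\<exists>\<alpha> :: nat \<Rightarrow> 'm \<Rightarrow> real ^ 'n. \<phi> A = (\<Sum>r<R. outer_prod (\<alpha> r))"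
    then obtain \<beta> :: "nat \<Rightarrow> 'm \<Rightarrow> real ^ 'n" where "\<phi> A = (\<Sum>r<R. outer_prod (\<beta> r))" ..
    moreover have "\<forall>r. \<exists>\<alpha>. \<phi> (outer_prod \<alpha>) = outer_prod (\<beta> r)" by (intro allI onto)
    then obtain \<alpha> where "\<And>r. \<phi> (outer_prod (\<alpha> r)) = outer_prod (\<beta> r)"
      unfolding choice_iff by blast
    ultimately have "\<phi> A = \<phi> (\<Sum>r<R. outer_prod (\<alpha> r))" by (simp add: linear_sum[OF assms(1)])
    then show "\<exists>\<alpha> :: nat \<Rightarrow> 'm \<Rightarrow> real ^ 'n. A = (\<Sum>r<R. outer_prod (\<alpha> r))"
      using assms(2) by (metis bij_pointE)
  next
    assume "\<exists>\<alpha> :: nat \<Rightarrow> 'm \<Rightarrow> real ^ 'n. A = (\<Sum>r<R. outer_prod (\<alpha> r))"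
    then obtain \<alpha> :: "nat \<Rightarrow> 'm \<Rightarrow> real ^ 'n" where "A = (\<Sum>r<R. outer_prod (\<alpha> r))" ..
    then have "\<phi> A = (\<Sum>r<R. outer_prod (\<lambda>k. B (\<tau> k) *v \<alpha> r (\<tau> k)))"
      by (simp add: linear_sum[OF assms(1)] \<phi>)
    then show "\<exists>\<alpha> :: nat \<Rightarrow> 'm \<Rightarrow> real ^ 'n. \<phi> A = (\<Sum>r<R. outer_prod (\<alpha> r))" 
      by (intro exI[of _ "\<lambda>r k. B (\<tau> k) *v \<alpha> r (\<tau> k)"])
  qed
  then show "rank_preserver \<phi>" unfolding rank_preserver_def cp_rank_def by simp
qed

end
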